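(* Let $(G,P,\theta)$ be an algebraic dynamical system, $S=G\rtimes_\theta P$, and let $F$ be a finite subset of $S$. Then $F$ is a foundation set for $S$ if and only if $F\cap (G\rtimes_\theta P^{(\mathrm{fin})})$ is a foundation set for $S$.
   Context: All semigroups are countable, discrete and left cancellative. A semigroup is right LCM if the intersection of two principal right ideals is either empty or again a principal right ideal. An algebraic dynamical system $(G,P,\theta)$ is an action $\theta$ of a right LCM semigroup $P$ with identity by injective endomorphisms of a group $G$ (so $\theta_p\theta_q=\theta_{pq}$, $\theta_1=\mathrm{id}$) such that $pP\cap qP=rP$ implies $\theta_p(G)\cap\theta_q(G)=\theta_r(G)$ for all $p,q,r\in P$. $G\rtimes_\theta P$ is the set $G\times P$ with product $(g,p)(h,q)=(g\theta_p(h),pq)$; it is a right LCM semigroup with identity. $P^{(\mathrm{fin})}$ is the subsemigroup of those $p\in P$ for which $G/\theta_p(G)$ is finite, and $G\rtimes_\theta P^{(\mathrm{fin})}=\{(g,p)\in S\mid p\in P^{(\mathrm{fin})}\}$. A finite subset $F\subset S$ is a foundation set for $S$ if for every $s\in S$ there is $t\in F$ with $sS\cap tS\neq\emptyset$. *)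

theory Defs
  imports "HOL-Algebra.Left_Coset" "HOL-Library.Countable_Set"
begin

definition principal_right_ideal :: "('a, 'm) monoid_scheme \<Rightarrow> 'a \<Rightarrow> 'a set" where
  "principal_right_ideal S s = {s \<otimes>\<^bsub>S\<^esub> x | x. x \<in> carrier S}"

text \<open>
  Right LCM semigroups with identity. As everywhere in this theory, semigroups are
  countable and left cancellative; they are discrete, so no topology is involved.
\<close>

locale right_lcm_monoid = monoid S for S (structure) +
  assumes countable_carrier: "countable (carrier S)"
    and left_cancel: "\<lbrakk>s \<in> carrier S; x \<in> carrier S; y \<in> carrier S; s \<otimes> x = s \<otimes> y\<rbrakk> \<Longrightarrow> x = y"
    and right_lcm: "\<lbrakk>s \<in> carrier S; t \<in> carrier S\<rbrakk> \<Longrightarrow>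
      principal_right_ideal S s \<inter> principal_right_ideal S t = {} \<or>
      (\<exists>r\<in>carrier S. principal_right_ideal S s \<inter> principal_right_ideal S t = principal_right_ideal S r)"

text \<open>
  The countability of \<open>G\<close> comes from the standing assumption, which applies to the
  semidirect product of \<open>G\<close> and \<open>P\<close>.
\<close>

locale algebraic_dynamical_system =
  G: group G + P: right_lcm_monoid P
  for G :: "('g, 'm) monoid_scheme" (structure)
    and P :: "('p, 'n) monoid_scheme" (structure)
    and \<theta> :: "'p \<Rightarrow> 'g \<Rightarrow> 'g" +
  assumes countable_group: "countable (carrier G)"
    and endo: "p \<in> carrier P \<Longrightarrow> \<theta> p \<in> hom G G"
    and inj_endo: "p \<in> carrier P \<Longrightarrow> inj_on (\<theta> p) (carrier G)"
    and action_mult: "\<lbrakk>p \<in> carrier P; q \<in> carrier P; g \<in> carrier G\<rbrakk> \<Longrightarrow>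
      \<theta> p (\<theta> q g) = \<theta> (p \<otimes>\<^bsub>P\<^esub> q) g"
    and action_one: "g \<in> carrier G \<Longrightarrow> \<theta> \<one>\<^bsub>P\<^esub> g = g"
    and preserves_order: "\<lbrakk>p \<in> carrier P; q \<in> carrier P; r \<in> carrier P;
      principal_right_ideal P p \<inter> principal_right_ideal P q = principal_right_ideal P r\<rbrakk> \<Longrightarrow>
      \<theta> p ` carrier G \<inter> \<theta> q ` carrier G = \<theta> r ` carrier G"

definition semidirect_product ::
  "('g, 'm) monoid_scheme \<Rightarrow> ('p, 'n) monoid_scheme \<Rightarrow> ('p \<Rightarrow> 'g \<Rightarrow> 'g) \<Rightarrow> ('g \<times> 'p) monoid" where
  "semidirect_product G P \<theta> =
    \<lparr>carrier = carrier G \<times> carrier P,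
     mult = (\<lambda>(g, p) (h, q). (g \<otimes>\<^bsub>G\<^esub> \<theta> p h, p \<otimes>\<^bsub>P\<^esub> q)),
     one = (\<one>\<^bsub>G\<^esub>, \<one>\<^bsub>P\<^esub>)\<rparr>"

text \<open>
  \<open>\<theta> p ` carrier G\<close> need not be normal in \<open>G\<close>, so \<open>G / \<theta>\<^sub>p(G)\<close> is the set of its left cosets.
\<close>

definition finite_index_part ::
  "('g, 'm) monoid_scheme \<Rightarrow> ('p, 'n) monoid_scheme \<Rightarrow> ('p \<Rightarrow> 'g \<Rightarrow> 'g) \<Rightarrow> 'p set" where
  "finite_index_part G P \<theta> = {p \<in> carrier P. finite (lcosets\<^bsub>G\<^esub> (\<theta> p ` carrier G))}"

definition semidirect_finite_part ::
  "('g, 'm) monoid_scheme \<Rightarrow> ('p, 'n) monoid_scheme \<Rightarrow> ('p \<Rightarrow> 'g \<Rightarrow> 'g) \<Rightarrow> ('g \<times> 'p) set" where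
  "semidirect_finite_part G P \<theta> =
    {(g, p) \<in> carrier (semidirect_product G P \<theta>). p \<in> finite_index_part G P \<theta>}"

definition foundation_set :: "('a, 'm) monoid_scheme \<Rightarrow> 'a set \<Rightarrow> bool" where
  "foundation_set S F \<longleftrightarrow> finite F \<and> F \<subseteq> carrier S \<and>
    (\<forall>s\<in>carrier S. \<exists>t\<in>F. principal_right_ideal S s \<inter> principal_right_ideal S t \<noteq> {})"

end

theory Submission
  imports Defs
begin

text \<open>
  Fix \<open>(g, p)\<close>. Successively replacing \<open>p\<close> by least common multiples with the
  second components of \<open>F\<close> yields \<open>r \<in> pP\<close> such that every such component \<open>q\<close> satisfies
  \<open>r \<in> qP\<close> or \<open>rP \<inter> qP = \<emptyset>\<close>. Testing the foundation set property on all \<open>(g', r)\<close>, and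
  using \<open>\<theta>\<^sub>r(G) \<subseteq> \<theta>\<^sub>q(G)\<close> in the first case, shows that \<open>G\<close> is the union of the cosets
  \<open>h \<theta>\<^sub>q(G)\<close> with \<open>(h, q) \<in> F\<close> and \<open>r \<in> qP\<close>. By B. H. Neumann's lemma those of finite index
  already cover \<open>G\<close>; one that contains \<open>g\<close> comes from a pair \<open>(h, q)\<close> whose principal right
  ideal meets that of \<open>(g, p)\<close>.
\<close>

section \<open>Coverings of a group by cosets\<close>

lemma (in group) mem_mult_l_coset_iff:
  assumes "a \<in> carrier G" "x \<in> carrier G" "y \<in> carrier G" "H \<subseteq> carrier G"
  shows "y \<in> (a \<otimes> x) <# H \<longleftrightarrow> inv a \<otimes> y \<in> x <# H"
proof -
  have "y = a \<otimes> x \<otimes> h \<longleftrightarrow> inv a \<otimes> y = x \<otimes> h" if "h \<in> H" for h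
  proof -
    have h: "h \<in> carrier G"
      using assms that by blast
    show ?thesis
      using assms h inv_solve_left[of "x \<otimes> h" a y] by (auto simp: m_assoc)
  qed
  then show ?thesis
    unfolding l_coset_def by blast
qed

lemma (in group) l_coset_in_lcosets: "x \<in> carrier G \<Longrightarrow> x <# H \<in> lcosets H"
  by (auto simp: LCOSETS_def)

text \<open>Induction on the number of subgroups. A coset of \<open>H\<close> outside the finite
  family \<open>\<C>\<close> would have to be covered by cosets of the other subgroups. Every coset
  of \<open>H\<close> is a left translate of it, so all cosets of \<open>H\<close> in
  \<open>\<C>\<close> could be traded for translates of those others, leaving a finite cover with
  one subgroup fewer.\<close>

lemma (in group) finite_infinite_index_cosets_not_cover:
  assumes "finite \<H>" and "\<And>H. H \<in> \<H> \<Longrightarrow> subgroup H G \<and> infinite (lcosets H)"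
    and "finite \<C>" and "\<C> \<subseteq> (\<Union>H\<in>\<H>. lcosets H)"
  shows "\<not> carrier G \<subseteq> \<Union>\<C>"
  using assms
proof (induction \<H> arbitrary: \<C> rule: finite_induct)
  case empty
  then show ?case by auto
next
  case (insert H \<H>)
  have H: "subgroup H G" "infinite (lcosets H)"
    using insert.prems(1) by auto
  define \<D> where "\<D> = \<C> - lcosets H"
  have \<D>: "finite \<D>" "\<D> \<subseteq> (\<Union>H\<in>\<H>. lcosets H)"
    using insert.prems(2,3) by (auto simp: \<D>_def)
  obtain C where C: "C \<in> lcosets H" "C \<notin> \<C>"
    using H(2) insert.prems(2) by (meson finite_subset subsetI)
  then obtain c where c: "c \<in> carrier G" "C = c <# H"
    by (auto simp: LCOSETS_def)
  show ?case
  proof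
    assume cover: "carrier G \<subseteq> \<Union>\<C>"
    \<comment> \<open>Distinct cosets of \<open>H\<close> are disjoint and \<open>C\<close> is not
      in \<open>\<C>\<close>, so a member of \<open>\<C>\<close> that meets \<open>C\<close> is not
      a coset of \<open>H\<close>.\<close>
    have C_sub: "C \<subseteq> \<Union>\<D>"
    proof
      fix y assume y: "y \<in> C"
      have "y \<in> carrier G"
        using y C(1) lcosets_subset_PowG[OF H(1)] by blast
      then obtain D where D: "D \<in> \<C>" "y \<in> D"
        using cover by blast
      have "D \<notin> lcosets H"
        using lcos_disjoint[OF H(1) _ C(1), of D] D y C(2) by blast
      then show "y \<in> \<Union>\<D>"
        using D by (auto simp: \<D>_def)
    qed
    define \<A> where "\<A> = \<C> \<inter> lcosets H"
    \<comment> \<open>Left translation by \<open>b \<otimes> inv c\<close> carries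
      \<open>C = c <# H\<close> onto \<open>b <# H\<close>, hence the cover \<open>\<D>\<close> of
      \<open>C\<close> to a cover of \<open>b <# H\<close>. Choosing a single \<open>b\<close> for
      each coset keeps \<open>\<E>\<close> finite.\<close>
    define \<E> where "\<E> = \<D> \<union> (\<Union>b\<in>(\<lambda>A. SOME b. b \<in> carrier G \<and> A = b <# H) ` \<A>.
      (\<lambda>D. (b \<otimes> inv c) <# D) ` \<D>)"
    have rep: "(SOME b. b \<in> carrier G \<and> A = b <# H) \<in> carrier G \<and>
      A = (SOME b. b \<in> carrier G \<and> A = b <# H) <# H" if "A \<in> \<A>" for A
      by (rule someI_ex) (use that in \<open>auto simp: \<A>_def LCOSETS_def\<close>)
    have fin: "finite \<E>"
      using insert.prems(2) \<D>(1) by (auto simp: \<E>_def \<A>_def)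
    have cosets: "\<E> \<subseteq> (\<Union>H\<in>\<H>. lcosets H)"
    proof -
      have "(b \<otimes> inv c) <# D \<in> (\<Union>H\<in>\<H>. lcosets H)"
        if b: "b \<in> carrier G" and D: "D \<in> \<D>" for b D
      proof -
        obtain K x where K: "K \<in> \<H>" "x \<in> carrier G" "D = x <# K"
          using D \<D>(2) by (auto simp: LCOSETS_def)
        have "K \<subseteq> carrier G"
          using insert.prems(1) K(1) subgroup.subset by blast
        then have "(b \<otimes> inv c) <# D = (b \<otimes> inv c \<otimes> x) <# K"
          using K b c(1) by (simp add: lcos_m_assoc)
        then show ?thesis
          using K b c(1) l_coset_in_lcosets[of "b \<otimes> inv c \<otimes> x" K] by auto
      qed
      then show ?thesis
        using \<D>(2) rep unfolding \<E>_def by blast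
    qed
    have "carrier G \<subseteq> \<Union>\<E>"
    proof
      fix y assume y: "y \<in> carrier G"
      then obtain A where A: "A \<in> \<C>" "y \<in> A"
        using cover by blast
      show "y \<in> \<Union>\<E>"
      proof (cases "A \<in> lcosets H")
        case False
        then show ?thesis
          using A by (auto simp: \<E>_def \<D>_def)
      next
        case True
        then have "A \<in> \<A>"
          using A by (simp add: \<A>_def)
        define b where "b = (SOME b. b \<in> carrier G \<and> A = b <# H)"
        have b: "b \<in> carrier G" "A = b <# H"
          using rep[OF \<open>A \<in> \<A>\<close>] by (simp_all add: b_def)
        obtain h where h: "h \<in> H" "y = b \<otimes> h"
          using A(2) b(2) by (auto simp: l_coset_def)
        have "c \<otimes> h \<in> C"
          using c(2) h(1) by (auto simp: l_coset_def)
        then obtain D where D: "D \<in> \<D>" "c \<otimes> h \<in> D"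
          using C_sub by blast
        have hG: "h \<in> carrier G"
          using h(1) H(1) by (meson subgroup.mem_carrier)
        have "inv c \<otimes> (c \<otimes> h) = h"
          using c(1) hG by (simp add: m_assoc[symmetric])
        then have "y = b \<otimes> inv c \<otimes> (c \<otimes> h)"
          using h(2) b(1) c(1) hG by (simp add: m_assoc)
        then have "y \<in> (b \<otimes> inv c) <# D"
          using D(2) by (auto simp: l_coset_def)
        then show ?thesis
          using D(1) \<open>A \<in> \<A>\<close> unfolding \<E>_def b_def by blast
      qed
    qed
    then show False
      using insert.IH[OF _ fin cosets] insert.prems(1) by blast
  qed
qed

text \<open>
  B. H. Neumann's lemma. Let \<open>T a\<close> be the translate by \<open>a\<close> of the union of the finite-index
  cosets. Only finitely many sets occur among the \<open>T a\<close>, and each complement of a \<open>T a\<close> is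
  covered by finitely many cosets of infinite index. If \<open>T \<one>\<close> were not all of \<open>G\<close>, these
  complements would cover \<open>G\<close>.
\<close>

theorem (in group) neumann_coset_cover:
  assumes I: "finite I" and x: "\<And>i. i \<in> I \<Longrightarrow> x i \<in> carrier G"
    and H: "\<And>i. i \<in> I \<Longrightarrow> subgroup (H i) G"
    and cover: "carrier G \<subseteq> (\<Union>i\<in>I. x i <# H i)"
  shows "carrier G \<subseteq> (\<Union>i\<in>{i \<in> I. finite (lcosets (H i))}. x i <# H i)"
proof (rule ccontr)
  define J where "J = {i \<in> I. finite (lcosets (H i))}"
  define T where "T = (\<lambda>a. \<Union>i\<in>J. (a \<otimes> x i) <# H i)"
  have J: "finite J" "J \<subseteq> I"
    using I by (auto simp: J_def)
  assume "\<not> carrier G \<subseteq> (\<Union>i\<in>{i \<in> I. finite (lcosets (H i))}. x i <# H i)"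
  then obtain g where g: "g \<in> carrier G" "\<And>i. i \<in> J \<Longrightarrow> g \<notin> x i <# H i"
    unfolding J_def by blast
  have T_iff: "y \<in> T a \<longleftrightarrow> (\<exists>i\<in>J. inv a \<otimes> y \<in> x i <# H i)"
    if "a \<in> carrier G" "y \<in> carrier G" for a y
  proof -
    have "y \<in> (a \<otimes> x i) <# H i \<longleftrightarrow> inv a \<otimes> y \<in> x i <# H i" if "i \<in> J" for i
      using J(2) that x[of i] subgroup.subset[OF H[of i]] \<open>a \<in> carrier G\<close> \<open>y \<in> carrier G\<close>
      by (intro mem_mult_l_coset_iff) auto
    then show ?thesis
      unfolding T_def by blast
  qed
  \<comment> \<open>Translating a coset of \<open>H i\<close> gives another coset of
    \<open>H i\<close>, and for \<open>i \<in> J\<close> there are only finitely many of these to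
    form unions from.\<close>
  have "T ` carrier G \<subseteq> Union ` Pow (\<Union>i\<in>J. lcosets (H i))"
  proof clarify
    fix a assume a: "a \<in> carrier G"
    have "(a \<otimes> x i) <# H i \<in> lcosets (H i)" if "i \<in> J" for i
      using J(2) a that x by (intro l_coset_in_lcosets) auto
    then have "(\<lambda>i. (a \<otimes> x i) <# H i) ` J \<subseteq> (\<Union>i\<in>J. lcosets (H i))"
      by auto
    then show "T a \<in> Union ` Pow (\<Union>i\<in>J. lcosets (H i))"
      unfolding T_def by blast
  qed
  moreover have "finite (\<Union>i\<in>J. lcosets (H i))"
    using J(1) by (auto simp: J_def)
  ultimately have "finite (T ` carrier G)"
    by (meson finite_Pow_iff finite_imageI finite_subset)
  \<comment> \<open>One translating element is kept for each value of \<open>T\<close>; this makes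
    the family \<open>\<C>\<close> below finite.\<close>
  then obtain A where A: "A \<subseteq> carrier G" "finite A" "T ` carrier G = T ` A"
    by (metis finite_subset_image subset_refl)
  define \<C> where "\<C> = (\<lambda>(a, i). (a \<otimes> x i) <# H i) ` (A \<times> (I - J))"
  have "carrier G \<subseteq> \<Union>\<C>"
  proof
    fix y assume y: "y \<in> carrier G"
    \<comment> \<open>The translation that takes the uncovered point \<open>g\<close> to
      \<open>y\<close> gives a translate of \<open>T \<one>\<close> that misses \<open>y\<close>.
      Since the original cosets, translated by the representative \<open>a\<close>, still cover
      \<open>G\<close>, one of infinite index must contain \<open>y\<close>.\<close>
    have "inv (y \<otimes> inv g) \<otimes> y = g"
      using y g(1) by (simp add: inv_mult_group m_assoc)
    then have "y \<notin> T (y \<otimes> inv g)"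
      using T_iff[of "y \<otimes> inv g" y] y g by auto
    moreover obtain a where a: "a \<in> A" "T (y \<otimes> inv g) = T a"
      using A(3) y g(1) by (metis imageE imageI inv_closed m_closed)
    ultimately have "y \<notin> T a"
      by simp
    have aG: "a \<in> carrier G"
      using a(1) A(1) by blast
    have "inv a \<otimes> y \<in> carrier G"
      using aG y by simp
    then obtain i where i: "i \<in> I" "inv a \<otimes> y \<in> x i <# H i"
      using cover by blast
    then have "i \<in> I - J"
      using \<open>y \<notin> T a\<close> T_iff[OF aG y] by auto
    moreover have "y \<in> (a \<otimes> x i) <# H i"
      using i mem_mult_l_coset_iff[OF aG x[OF i(1)] y subgroup.subset[OF H[OF i(1)]]] by simp
    ultimately show "y \<in> \<Union>\<C>"
      using a(1) unfolding \<C>_def by auto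
  qed
  moreover have "(a \<otimes> x i) <# H i \<in> lcosets (H i)" if "a \<in> A" "i \<in> I - J" for a i
    using A(1) that x by (intro l_coset_in_lcosets) auto
  then have "\<C> \<subseteq> (\<Union>K\<in>H ` (I - J). lcosets K)"
    by (auto simp: \<C>_def)
  moreover have "finite \<C>"
    using A(2) I by (simp add: \<C>_def)
  moreover have "subgroup K G \<and> infinite (lcosets K)" if "K \<in> H ` (I - J)" for K
    using that H by (auto simp: J_def)
  moreover have "finite (H ` (I - J))"
    using I by simp
  ultimately show False
    using finite_infinite_index_cosets_not_cover[of "H ` (I - J)" \<C>] by metis
qed

section \<open>Foundation sets\<close>

context right_lcm_monoid
begin

lemma principal_right_ideal_self: "s \<in> carrier S \<Longrightarrow> s \<in> principal_right_ideal S s"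
  unfolding principal_right_ideal_def by (auto intro: exI[of _ \<one>])

lemma principal_right_ideal_closed:
  "s \<in> carrier S \<Longrightarrow> t \<in> principal_right_ideal S s \<Longrightarrow> t \<in> carrier S"
  by (auto simp: principal_right_ideal_def)

lemma principal_right_ideal_mono:
  "s \<in> carrier S \<Longrightarrow> t \<in> principal_right_ideal S s \<Longrightarrow>
    principal_right_ideal S t \<subseteq> principal_right_ideal S s"
  by (auto simp: principal_right_ideal_def m_assoc)

text \<open>The elements of \<open>Q\<close> are treated one at a time: if the ideals of the current
  \<open>r\<close> and of \<open>q\<close> meet, \<open>r\<close> is replaced by a generator of
  their intersection, otherwise it is kept.\<close>

lemma ex_multiple_deciding:
  assumes "finite Q" "Q \<subseteq> carrier S" "p \<in> carrier S"
  shows "\<exists>r\<in>principal_right_ideal S p. \<forall>q\<in>Q. r \<in> principal_right_ideal S q \<or>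
    principal_right_ideal S r \<inter> principal_right_ideal S q = {}"
  using assms(1,2)
proof (induction Q rule: finite_induct)
  case empty
  then show ?case
    using principal_right_ideal_self[OF assms(3)] by blast
next
  case (insert q Q)
  then obtain r where r: "r \<in> principal_right_ideal S p"
    "\<And>q'. q' \<in> Q \<Longrightarrow> r \<in> principal_right_ideal S q' \<or>
      principal_right_ideal S r \<inter> principal_right_ideal S q' = {}"
    by (metis insert_subset)
  have carr: "r \<in> carrier S" "q \<in> carrier S"
    using r(1) assms(3) principal_right_ideal_closed insert.prems by auto
  show ?case
  proof (cases "principal_right_ideal S r \<inter> principal_right_ideal S q = {}")
    case True
    then show ?thesis
      using r by blast
  next
    case False
    then obtain m where m: "m \<in> carrier S"
      "principal_right_ideal S r \<inter> principal_right_ideal S q = principal_right_ideal S m"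
      using right_lcm[OF carr] by blast
    have mem: "m \<in> principal_right_ideal S r" "m \<in> principal_right_ideal S q"
      using m principal_right_ideal_self by blast+
    have sub: "principal_right_ideal S m \<subseteq> principal_right_ideal S r"
      using m(2) by blast
    \<comment> \<open>Both alternatives pass from \<open>r\<close> to its right multiples, so
      decisions made earlier survive.\<close>
    have "m \<in> principal_right_ideal S q' \<or>
      principal_right_ideal S m \<inter> principal_right_ideal S q' = {}" if "q' \<in> Q" for q'
    proof -
      have "q' \<in> carrier S"
        using insert.prems that by auto
      then show ?thesis
        using r(2)[OF that] mem(1) sub principal_right_ideal_mono[of q' r] by blast
    qed
    moreover have "m \<in> principal_right_ideal S p"
      using mem(1) r(1) principal_right_ideal_mono[OF assms(3)] by blast
    ultimately show ?thesis
      using mem(2) by blast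
  qed
qed

end

section \<open>Principal right ideals and foundation sets of the semidirect product\<close>

context algebraic_dynamical_system
begin

lemma subgroup_image: "p \<in> carrier P \<Longrightarrow> subgroup (\<theta> p ` carrier G) G"
  by (simp add: G.is_group endo group_hom.img_is_subgroup group_hom.intro group_hom_axioms.intro)

lemma endo_closed: "p \<in> carrier P \<Longrightarrow> g \<in> carrier G \<Longrightarrow> \<theta> p g \<in> carrier G"
  using endo by (auto simp: hom_def)

lemma image_mono:
  assumes "q \<in> carrier P" "r \<in> principal_right_ideal P q"
  shows "\<theta> r ` carrier G \<subseteq> \<theta> q ` carrier G"
proof -
  obtain a where a: "a \<in> carrier P" "r = q \<otimes>\<^bsub>P\<^esub> a"
    using assms(2) by (auto simp: principal_right_ideal_def)
  have "\<theta> r g = \<theta> q (\<theta> a g)" if "g \<in> carrier G" for g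
    using that a assms(1) by (simp add: action_mult)
  then show ?thesis
    using a endo_closed by auto
qed

lemma semidirect_carrier: "carrier (semidirect_product G P \<theta>) = carrier G \<times> carrier P"
  by (simp add: semidirect_product_def)

text \<open>In a right multiple of \<open>(g, p)\<close> the two components of the other factor act
  independently, so the ideal is a full product of sets and intersections can be tested
  componentwise.\<close>

lemma semidirect_principal_right_ideal:
  "principal_right_ideal (semidirect_product G P \<theta>) (g, p) =
    (g <# \<theta> p ` carrier G) \<times> principal_right_ideal P p"
  by (auto simp: principal_right_ideal_def semidirect_product_def l_coset_def)

lemma semidirect_principal_right_ideals_meet_iff:
  "principal_right_ideal (semidirect_product G P \<theta>) (g, p) \<inter>
    principal_right_ideal (semidirect_product G P \<theta>) (h, q) \<noteq> {} \<longleftrightarrow>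
    (g <# \<theta> p ` carrier G) \<inter> (h <# \<theta> q ` carrier G) \<noteq> {} \<and>
    principal_right_ideal P p \<inter> principal_right_ideal P q \<noteq> {}"
  by (auto simp: semidirect_principal_right_ideal)

lemma foundation_set_finite_part:
  assumes "foundation_set (semidirect_product G P \<theta>) F"
  shows "foundation_set (semidirect_product G P \<theta>) (F \<inter> semidirect_finite_part G P \<theta>)"
proof -
  let ?S = "semidirect_product G P \<theta>"
  let ?im = "\<lambda>q. \<theta> q ` carrier G"
  have F: "finite F" "F \<subseteq> carrier G \<times> carrier P"
    and meets: "\<And>s. s \<in> carrier G \<times> carrier P \<Longrightarrow>
      \<exists>t\<in>F. principal_right_ideal ?S s \<inter> principal_right_ideal ?S t \<noteq> {}"
    using assms unfolding foundation_set_def semidirect_carrier by blast+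
  have "\<exists>t\<in>F \<inter> semidirect_finite_part G P \<theta>.
    principal_right_ideal ?S (g, p) \<inter> principal_right_ideal ?S t \<noteq> {}"
    if g: "g \<in> carrier G" and p: "p \<in> carrier P" for g p
  proof -
    have fin: "finite (snd ` F)" and sub: "snd ` F \<subseteq> carrier P"
      using F by auto
    obtain r where r: "r \<in> principal_right_ideal P p"
      and r_dec: "\<And>q. q \<in> snd ` F \<Longrightarrow> r \<in> principal_right_ideal P q \<or>
        principal_right_ideal P r \<inter> principal_right_ideal P q = {}"
      using P.ex_multiple_deciding[OF fin sub p] by blast
    have rP: "r \<in> carrier P"
      using r p P.principal_right_ideal_closed by blast
    define I where "I = {t \<in> F. r \<in> principal_right_ideal P (snd t)}"
    have I: "finite I" "I \<subseteq> carrier G \<times> carrier P"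
      using F by (auto simp: I_def)
    have "carrier G \<subseteq> (\<Union>t\<in>I. fst t <# ?im (snd t))"
    proof
      fix y assume y: "y \<in> carrier G"
      then obtain h q where hq: "(h, q) \<in> F"
        "(y <# ?im r) \<inter> (h <# ?im q) \<noteq> {}"
        "principal_right_ideal P r \<inter> principal_right_ideal P q \<noteq> {}"
        using meets[of "(y, r)"] rP
        by (metis SigmaI semidirect_principal_right_ideals_meet_iff surj_pair)
      have rq: "r \<in> principal_right_ideal P q"
        using r_dec[of q] hq(1,3) by force
      have hqc: "h \<in> carrier G" "q \<in> carrier P"
        using F(2) hq(1) by auto
      \<comment> \<open>Enlarging the subgroup from the image of \<open>\<theta> r\<close> to that
        of \<open>\<theta> q\<close> turns the given intersection into one of two cosets of the same
        subgroup, which therefore coincide.\<close>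
      have "(y <# ?im r) \<subseteq> y <# ?im q"
        using image_mono[OF hqc(2) rq] unfolding l_coset_def by blast
      then have "y <# ?im q = h <# ?im q"
        using hq(2) G.lcos_disjoint[OF subgroup_image[OF hqc(2)]]
          G.l_coset_in_lcosets[OF y] G.l_coset_in_lcosets[OF hqc(1)] by blast
      then have "y \<in> h <# ?im q"
        using G.lcos_self[OF y subgroup_image[OF hqc(2)]] by simp
      then show "y \<in> (\<Union>t\<in>I. fst t <# ?im (snd t))"
        using hq(1) rq by (force simp: I_def)
    qed
    then have "carrier G \<subseteq>
      (\<Union>t\<in>{t \<in> I. finite (lcosets (?im (snd t)))}. fst t <# ?im (snd t))"
      using I subgroup_image
      by (intro G.neumann_coset_cover) auto
    then obtain h q where hq: "(h, q) \<in> I" "finite (lcosets (?im q))" "g \<in> h <# ?im q"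
      using g by fastforce
    \<comment> \<open>The ideals of \<open>(g, p)\<close> and \<open>(h, q)\<close> share the point
      \<open>(g, r)\<close>: \<open>g\<close> lies in both cosets, and \<open>r\<close> is a right
      multiple of both \<open>p\<close> and \<open>q\<close>.\<close>
    have "(h, q) \<in> F \<inter> semidirect_finite_part G P \<theta>"
      using hq(1,2) I(2)
      by (auto simp: I_def semidirect_finite_part_def finite_index_part_def semidirect_carrier)
    moreover have "g \<in> g <# ?im p"
      using G.lcos_self[OF g subgroup_image[OF p]] .
    moreover have "r \<in> principal_right_ideal P q"
      using hq(1) by (simp add: I_def)
    ultimately show ?thesis
      using hq(3) r semidirect_principal_right_ideals_meet_iff[of g p h q] by blast
  qed
  then show ?thesis
    using F unfolding foundation_set_def semidirect_carrier by blast
qed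

end

lemma foundation_set_superset:
  assumes "foundation_set S E" "E \<subseteq> F" "finite F" "F \<subseteq> carrier S"
  shows "foundation_set S F"
  using assms unfolding foundation_set_def by blast

theorem proposition3p5:
  fixes G :: "('g, 'm) monoid_scheme"
    and P :: "('p, 'n) monoid_scheme"
    and \<theta> :: "'p \<Rightarrow> 'g \<Rightarrow> 'g"
    and F :: "('g \<times> 'p) set"
  assumes "algebraic_dynamical_system G P \<theta>"
    and "finite F" and "F \<subseteq> carrier (semidirect_product G P \<theta>)"
  shows "foundation_set (semidirect_product G P \<theta>) F \<longleftrightarrow>
    foundation_set (semidirect_product G P \<theta>) (F \<inter> semidirect_finite_part G P \<theta>)"
proof
  assume "foundation_set (semidirect_product G P \<theta>) F"
  then show "foundation_set (semidirect_product G P \<theta>) (F \<inter> semidirect_finite_part G P \<theta>)"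
    by (rule algebraic_dynamical_system.foundation_set_finite_part[OF assms(1)])
next
  assume "foundation_set (semidirect_product G P \<theta>) (F \<inter> semidirect_finite_part G P \<theta>)"
  then show "foundation_set (semidirect_product G P \<theta>) F"
    using Int_lower1 assms(2,3) by (rule foundation_set_superset)
qed

end
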